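(* Consider a data market instance with $n\ge 2$ buyers and 2 sellers with one dataset each. Each buyer has value $1$ for each dataset. The first $n-1$ buyers (the poor buyers) have a budget of $1$ each, and the $n$-th buyer (the rich buyer) has a budget of $n+1$. In this instance, a Nash equilibrium does not exist for convex pricing functions: there is no pair $(p_1,p_2)$ of convex pricing functions such that $r_1(p_1',p_2)\le r_1(p_1,p_2)$ and $r_2(p_1,p_2')\le r_2(p_1,p_2)$ for all convex pricing functions $p_1',p_2'$.
   Context: Datasets are divisible and non-rivalrous: each buyer may purchase any fraction in $[0,1]$ of each dataset, regardless of what others buy. A convex pricing function is a continuous, monotone non-decreasing, convex function $p:[0,1]\to\mathbb{R}_{\ge0}$ with $p(0)=0$; a fraction $x$ of a dataset with pricing function $p$ costs $p(x)$. Each seller $j\in\{1,2\}$ chooses a convex pricing function $p_j$. A buyer with budget $b$ and values $\tau_1,\tau_2$ for the two datasets purchases $(x_1,x_2)\in[0,1]^2$ maximizing $\tau_1x_1+\tau_2x_2$ subject to $p_1(x_1)+p_2(x_2)\le b$ (here $\tau_1=\tau_2=1$ for all buyers); if there are several maximizers, the buyer selects one according to an arbitrary fixed tie-breaking rule known to the sellers. Seller $j$ receives $p_j(x_j)$ from this buyer, and $r_j(p_1,p_2)$ is the total amount seller $j$ receives from all buyers. *)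

theory Defs
  imports "HOL-Analysis.Analysis"
begin

text \<open>Pricing functions have type \<^typ>\<open>real \<Rightarrow> real\<close>; only their values on \<open>{0..1}\<close> matter.\<close>

definition convex_pricing :: "(real \<Rightarrow> real) \<Rightarrow> bool" where
  "convex_pricing p \<longleftrightarrow>
     continuous_on {0..1} p \<and> mono_on {0..1} p \<and> convex_on {0..1} p \<and>
     (\<forall>x\<in>{0..1}. 0 \<le> p x) \<and> p 0 = 0"

definition budget_set :: "real \<Rightarrow> (real \<Rightarrow> real) \<Rightarrow> (real \<Rightarrow> real) \<Rightarrow> (real \<times> real) set" where
  "budget_set b p1 p2 = {(x1, x2). x1 \<in> {0..1} \<and> x2 \<in> {0..1} \<and> p1 x1 + p2 x2 \<le> b}"

definition demand ::
  "real \<Rightarrow> real \<Rightarrow> real \<Rightarrow> (real \<Rightarrow> real) \<Rightarrow> (real \<Rightarrow> real) \<Rightarrow> (real \<times> real) set" where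
  "demand \<tau>1 \<tau>2 b p1 p2 =
     {x. is_arg_max (\<lambda>(x1, x2). \<tau>1 * x1 + \<tau>2 * x2) (\<lambda>x. x \<in> budget_set b p1 p2) x}"

text \<open>
  The outcome of tie-breaking: \<open>sel i p1 p2\<close> is the bundle bought by buyer \<open>i\<close> when the sellers
  post \<open>p1\<close> and \<open>p2\<close>. Any choice among the maximizers is allowed; it may differ between buyers
  and depend on the posted pricing functions.
\<close>

type_synonym selection = "nat \<Rightarrow> (real \<Rightarrow> real) \<Rightarrow> (real \<Rightarrow> real) \<Rightarrow> real \<times> real"

definition tie_breaking_rule ::
  "nat \<Rightarrow> (nat \<Rightarrow> real) \<Rightarrow> (nat \<Rightarrow> real) \<Rightarrow> (nat \<Rightarrow> real) \<Rightarrow> selection \<Rightarrow> bool" where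
  "tie_breaking_rule n \<tau>1 \<tau>2 b sel \<longleftrightarrow>
     (\<forall>i\<in>{1..n}. \<forall>p1 p2. convex_pricing p1 \<longrightarrow> convex_pricing p2 \<longrightarrow>
        sel i p1 p2 \<in> demand (\<tau>1 i) (\<tau>2 i) (b i) p1 p2)"

definition revenue1 :: "nat \<Rightarrow> selection \<Rightarrow> (real \<Rightarrow> real) \<Rightarrow> (real \<Rightarrow> real) \<Rightarrow> real" where
  "revenue1 n sel p1 p2 = (\<Sum>i\<in>{1..n}. p1 (fst (sel i p1 p2)))"

definition revenue2 :: "nat \<Rightarrow> selection \<Rightarrow> (real \<Rightarrow> real) \<Rightarrow> (real \<Rightarrow> real) \<Rightarrow> real" where
  "revenue2 n sel p1 p2 = (\<Sum>i\<in>{1..n}. p2 (snd (sel i p1 p2)))"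

definition nash_equilibrium :: "nat \<Rightarrow> selection \<Rightarrow> (real \<Rightarrow> real) \<Rightarrow> (real \<Rightarrow> real) \<Rightarrow> bool" where
  "nash_equilibrium n sel p1 p2 \<longleftrightarrow>
     convex_pricing p1 \<and> convex_pricing p2 \<and>
     (\<forall>p1'. convex_pricing p1' \<longrightarrow> revenue1 n sel p1' p2 \<le> revenue1 n sel p1 p2) \<and>
     (\<forall>p2'. convex_pricing p2' \<longrightarrow> revenue2 n sel p1 p2' \<le> revenue2 n sel p1 p2)"

text \<open>Buyers \<open>1, \<dots>, n - 1\<close> are poor, buyer \<open>n\<close> is rich.\<close>

definition market_budget :: "nat \<Rightarrow> nat \<Rightarrow> real" where
  "market_budget n i = (if i < n then 1 else real n + 1)"

text \<open>Maximizers exist, so tie-breaking rules exist for nonnegative budgets.\<close>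

lemma demand_nonempty:
  assumes p1: "convex_pricing p1" and p2: "convex_pricing p2" and b: "0 \<le> b"
  shows "demand \<tau>1 \<tau>2 b p1 p2 \<noteq> {}"
proof -
  let ?S = "{0..1} \<times> {0..1} :: (real \<times> real) set"
  let ?f = "\<lambda>x::real \<times> real. \<tau>1 * fst x + \<tau>2 * snd x"
  have eq: "budget_set b p1 p2 = {x \<in> ?S. p1 (fst x) + p2 (snd x) \<le> b}"
    by (auto simp: budget_set_def)
  have c1: "continuous_on ?S (\<lambda>x. p1 (fst x))"
    by (rule continuous_on_compose2[of "{0..1}" p1])
      (use p1 in \<open>auto simp: convex_pricing_def intro: continuous_on_fst continuous_on_id\<close>)
  have c2: "continuous_on ?S (\<lambda>x. p2 (snd x))"
    by (rule continuous_on_compose2[of "{0..1}" p2])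
      (use p2 in \<open>auto simp: convex_pricing_def intro: continuous_on_snd continuous_on_id\<close>)
  have S: "compact ?S" by (intro compact_Times) auto
  have S_closed: "closed ?S" using S by (rule compact_imp_closed)
  have c: "continuous_on ?S (\<lambda>x. p1 (fst x) + p2 (snd x))"
    using c1 c2 by (rule continuous_on_add)
  have "closed {x \<in> ?S. p1 (fst x) + p2 (snd x) \<le> b}"
    using continuous_on_closed_Collect_le[OF c continuous_on_const S_closed] .
  then have "compact (?S \<inter> {x \<in> ?S. p1 (fst x) + p2 (snd x) \<le> b})"
    using S by (intro compact_Int_closed)
  moreover have "?S \<inter> {x \<in> ?S. p1 (fst x) + p2 (snd x) \<le> b} = budget_set b p1 p2"
    unfolding eq by blast
  ultimately have "compact (budget_set b p1 p2)" by simp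
  moreover have "(0, 0) \<in> budget_set b p1 p2"
    using p1 p2 b by (auto simp: budget_set_def convex_pricing_def)
  moreover have "continuous_on (budget_set b p1 p2) ?f"
    by (intro continuous_on_add continuous_on_mult continuous_on_const
        continuous_on_fst continuous_on_snd continuous_on_id)
  ultimately obtain x where "x \<in> budget_set b p1 p2" "\<forall>y\<in>budget_set b p1 p2. ?f y \<le> ?f x"
    using continuous_attains_sup[of "budget_set b p1 p2" ?f] by blast
  then have "x \<in> demand \<tau>1 \<tau>2 b p1 p2"
    unfolding demand_def is_arg_max_linorder case_prod_unfold by force
  then show ?thesis by blast
qed

end

theory Submission
  imports Defs
begin

text \<open>
  Against every convex pricing function \<open>q\<close> of the opponent, a seller can secure a revenue strictly
  larger than \<open>n\<close>, whatever the tie-breaking. Since the budgets sum to \<open>2 * n\<close>, the two sellers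
  cannot both earn more than \<open>n\<close>, so one of them always has a profitable deviation.

  The deviation is a two-piece linear pricing function. If \<open>q 1 \<le> (n + 1) / 2\<close>, then it charges
  \<open>n + 1 - q 1\<close> for the whole dataset, which the rich buyer pays, and its first piece is cheap enough
  to attract more than half of each poor budget (if \<open>q 1 < 1\<close>, the rich buyer alone suffices). If \<open>q 1 > (n + 1) / 2\<close>, it slightly undercuts
  the chords of \<open>q\<close> between the prices \<open>0\<close>, \<open>1 / 2\<close> and \<open>(n + 1) / 2\<close>: the poor buyers then spend
  almost half of their budgets on it, while the rich buyer, who can extend the cheaper
  second piece beyond the point where \<open>q\<close> reaches \<open>(n + 1) / 2\<close>, spends more than \<open>(n + 1) / 2\<close>.
\<close>

section \<open>Demand at unit values, and what undercutting achieves\<close>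

lemma demand_unit_iff:
  "(x1, x2) \<in> demand 1 1 b p q \<longleftrightarrow>
     (x1, x2) \<in> budget_set b p q \<and> (\<forall>y1 y2. (y1, y2) \<in> budget_set b p q \<longrightarrow> y1 + y2 \<le> x1 + x2)"
  by (auto simp: demand_def is_arg_max_linorder)

text \<open>With equal values the demand set is symmetric in the sellers, although a tie-breaking
  rule need not be. This transfers bounds for the first seller to the second.\<close>

lemma demand_unit_swap:
  "(x1, x2) \<in> demand 1 1 b p q \<longleftrightarrow> (x2, x1) \<in> demand 1 1 b q p"
proof -
  have "(y1, y2) \<in> budget_set b p q \<longleftrightarrow> (y2, y1) \<in> budget_set b q p" for y1 y2
    by (auto simp: budget_set_def)
  then show ?thesis
    unfolding demand_unit_iff by (metis add.commute)
qed

lemma convex_on_chord_le: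
  fixes q :: "real \<Rightarrow> real"
  assumes q: "convex_on I q" and I: "w \<in> I" "v \<in> I" "c \<in> I" "d \<in> I"
    and ord: "w < v" "v \<le> c" "c < d"
  shows "(q v - q w) / (v - w) \<le> (q d - q c) / (d - c)"
proof -
  \<comment> \<open>Both chords are compared with the long chord over \<open>[w, d]\<close>.\<close>
  have "(q w - q v) / (w - v) \<le> (q w - q d) / (w - d)"
    using convex_on_slope_le(1)[OF q I(1,4), of v] ord by auto
  also have "\<dots> \<le> (q c - q d) / (c - d)"
    using convex_on_slope_le(2)[OF q I(1,4), of c] ord by auto
  finally show ?thesis
    using minus_divide_divide[of "q v - q w" "v - w"] minus_divide_divide[of "q d - q c" "d - c"]
    by simp
qed

text \<open>An exchange argument. A buyer paying less than \<open>p u\<close> holds less than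
  \<open>u\<close> of the first dataset and, by optimality, more than \<open>v\<close> of the
  second. Beyond \<open>v\<close>, convexity makes each unit of \<open>q\<close> cost at least the
  chord slope over \<open>[w, v]\<close>, which exceeds \<open>s\<close>; trading the second dataset
  for the first then increases the total.\<close>

lemma undercut_spending:
  assumes p: "convex_pricing p" and q: "convex_pricing q"
    and u: "u \<in> {0..1}"
    and slope_p: "\<And>x y. 0 \<le> x \<Longrightarrow> x \<le> y \<Longrightarrow> y \<le> u \<Longrightarrow> p y - p x \<le> s * (y - x)"
    and wv: "0 \<le> w" "w < v" "v \<le> 1"
    and qv: "q v \<le> b - p u"
    and slope_q: "s * (v - w) < q v - q w"
    and x: "(x1, x2) \<in> demand 1 1 b p q"
  shows "p u \<le> p x1"
proof (rule ccontr)
  assume "\<not> p u \<le> p x1"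
  then have less: "p x1 < p u" by simp
  have x01: "x1 \<in> {0..1}" "x2 \<in> {0..1}" and bud: "p x1 + q x2 \<le> b"
    and opt: "\<And>y1 y2. (y1, y2) \<in> budget_set b p q \<Longrightarrow> y1 + y2 \<le> x1 + x2"
    using x by (auto simp: demand_unit_iff budget_set_def)
  have x1u: "x1 < u"
    using p u x01 less unfolding convex_pricing_def mono_on_def by (meson not_le)
  have qx2: "b - p u < q x2"
  proof (rule ccontr)
    assume "\<not> b - p u < q x2"
    then have "(u, x2) \<in> budget_set b p q"
      using u x01 by (auto simp: budget_set_def)
    from opt[OF this] x1u show False by simp
  qed
  then have "q v < q x2" using qv by simp
  then have vx2: "v < x2"
    using q wv x01 unfolding convex_pricing_def mono_on_def
    by (metis atLeastAtMost_iff less_imp_le not_le order_trans)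
  have "0 < s * (u - x1)"
    using slope_p[of x1 u] x1u x01 less by auto
  then have s: "0 < s" using x1u by (simp add: zero_less_mult_iff)
  define r where "r = (q v - q w) / (v - w)"
  have sr: "s < r"
    using slope_q wv by (simp add: r_def less_divide_eq)
  \<comment> \<open>The buyer gives up \<open>k\<close> of the second dataset, saving at least
    \<open>r * k\<close>, which pays for \<open>h > k\<close> of the first. The two bounds in the
    minimum keep \<open>x2 - k\<close> above or at \<open>v\<close> and \<open>x1 + h\<close> below
    or at \<open>u\<close>.\<close>
  define k where "k = min (x2 - v) ((u - x1) * s / r)"
  define h where "h = k * r / s"
  have k: "0 < k" "k \<le> x2 - v" "k \<le> (u - x1) * s / r"
    using s sr x1u vx2 by (auto simp: k_def)
  have hk: "k < h" using s sr k by (simp add: h_def less_divide_eq)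
  have hu: "h \<le> u - x1"
    using k(3) s sr by (simp add: h_def field_simps)
  have "r \<le> (q x2 - q (x2 - k)) / (x2 - (x2 - k))"
    unfolding r_def using q wv x01 k
    by (intro convex_on_chord_le[of "{0..1}"]) (auto simp: convex_pricing_def)
  then have "q (x2 - k) \<le> q x2 - r * k"
    using k by (simp add: le_divide_eq)
  moreover have "p (x1 + h) \<le> p x1 + r * k"
    using slope_p[of x1 "x1 + h"] x01 hu hk k s by (simp add: h_def mult.commute)
  ultimately have "(x1 + h, x2 - k) \<in> budget_set b p q"
    using bud x01 hu hk k u wv by (auto simp: budget_set_def)
  from opt[OF this] hk show False by simp
qed

lemma full_purchase:
  assumes "convex_pricing p" "convex_pricing q" and "p 1 + q 1 \<le> b"
    and "(x1, x2) \<in> demand 1 1 b p q"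
  shows "x1 = 1"
proof -
  have "(1, 1) \<in> budget_set b p q"
    using assms by (auto simp: budget_set_def)
  then have "1 + 1 \<le> x1 + x2" and "(x1, x2) \<in> budget_set b p q"
    using assms(4) unfolding demand_unit_iff by blast+
  then show ?thesis by (auto simp: budget_set_def)
qed

section \<open>Two-piece linear pricing functions\<close>

definition kinked :: "real \<Rightarrow> real \<Rightarrow> real \<Rightarrow> real \<Rightarrow> real" where
  "kinked a d k x = a * x + max 0 ((d - a) * (x - k))"

lemma kinked_below: "a \<le> d \<Longrightarrow> x \<le> k \<Longrightarrow> kinked a d k x = a * x"
  using mult_nonneg_nonpos[of "d - a" "x - k"] by (simp add: kinked_def max_absorb1)

lemma kinked_above: "a \<le> d \<Longrightarrow> k \<le> x \<Longrightarrow> kinked a d k x = a * k + d * (x - k)"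
  using mult_nonneg_nonneg[of "d - a" "x - k"]
  by (simp add: kinked_def max_absorb2) (simp add: algebra_simps)

lemma kinked_slope_le:
  assumes "a \<le> d" "x \<le> y"
  shows "kinked a d k y - kinked a d k x \<le> d * (y - x)"
proof -
  have "(d - a) * (y - k) = (d - a) * (x - k) + (d - a) * (y - x)"
    by (simp add: algebra_simps)
  moreover have "0 \<le> (d - a) * (y - x)" using assms by simp
  ultimately have "max 0 ((d - a) * (y - k)) \<le> max 0 ((d - a) * (x - k)) + (d - a) * (y - x)"
    by linarith
  then show ?thesis by (simp add: kinked_def algebra_simps)
qed

text \<open>A linear function plus the positive part of an affine function is convex, since both
  summands are.\<close>

lemma convex_pricing_kinked:
  assumes "0 \<le> a" "a \<le> d" "0 \<le> k"
  shows "convex_pricing (kinked a d k)"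
proof -
  have mono: "kinked a d k x \<le> kinked a d k y" if "x \<le> y" for x y
    unfolding kinked_def using assms that
    by (intro add_mono max.mono mult_left_mono) auto
  have "convex_on {0..1} (kinked a d k)"
  proof (rule convex_onI)
    fix t x y :: real
    assume t: "0 < t" "t < 1"
    let ?M = "\<lambda>x. max 0 ((d - a) * (x - k))"
    let ?z = "(1 - t) *\<^sub>R x + t *\<^sub>R y"
    have "(d - a) * (?z - k) = (1 - t) * ((d - a) * (x - k)) + t * ((d - a) * (y - k))"
      by (simp add: algebra_simps)
    also have "\<dots> \<le> (1 - t) * ?M x + t * ?M y"
      using t by (intro add_mono mult_left_mono) auto
    finally have "?M ?z \<le> (1 - t) * ?M x + t * ?M y"
      using t by simp
    then show "kinked a d k ?z \<le> (1 - t) * kinked a d k x + t * kinked a d k y"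
      by (simp add: kinked_def algebra_simps)
  qed simp
  moreover have "continuous_on {0..1} (kinked a d k)"
    unfolding kinked_def by (intro continuous_intros)
  moreover have zero: "kinked a d k 0 = 0"
    using assms by (simp add: kinked_below)
  ultimately show ?thesis
    using mono mono[of 0] by (auto simp: convex_pricing_def mono_on_def)
qed

section \<open>Revenue secured against a given opponent\<close>

lemma convex_pricing_IVT:
  assumes q: "convex_pricing q" and c: "0 \<le> c" "c \<le> q 1"
  obtains y where "0 \<le> y" "y \<le> 1" "q y = c"
  using IVT'[of q 0 c 1] assms by (auto simp: convex_pricing_def)

lemma less_arg_if_less_price:
  assumes "convex_pricing q" "x \<in> {0..1}" "y \<in> {0..1}" "q x < q y"
  shows "x < y"
  using assms unfolding convex_pricing_def mono_on_def by (meson not_le)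

text \<open>The deviation passes through \<open>(k, t)\<close> and \<open>(1, e)\<close>. The rich
  buyer can exactly afford both full datasets, and the first piece undercuts \<open>q\<close> for
  the poor buyers.\<close>

lemma secured_low_price:
  assumes q: "convex_pricing q" and n: "n \<ge> (2::nat)"
    and B: "1 \<le> q 1" "q 1 \<le> (real n + 1) / 2"
  obtains p t e where "convex_pricing p" "(real n - 1) * t + e > real n"
    "\<And>x1 x2. (x1, x2) \<in> demand 1 1 1 p q \<Longrightarrow> t \<le> p x1"
    "\<And>x1 x2. (x1, x2) \<in> demand 1 1 (real n + 1) p q \<Longrightarrow> e \<le> p x1"
proof -
  obtain y where y: "0 \<le> y" "y \<le> 1" "q y = 1/2"
    using convex_pricing_IVT[OF q, of "1/2"] B by auto
  have y1: "y < 1" using y B by (cases "y = 1") auto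
  \<comment> \<open>The divisor 8 gives \<open>k - y = 4 * h\<close> for the midpoint
    \<open>k\<close> of \<open>y\<close> and 1. Then
    \<open>(1/2 - h) * k - (1/2 + h) * y = h * (2 - k - y)\<close> is nonnegative, which puts the
    slope \<open>t / k\<close> below the chord of \<open>q\<close> over
    \<open>[0, v]\<close>.\<close>
  define h where "h = (1 - y) / 8"
  have h: "0 < h" "h \<le> 1/8" using y y1 by (auto simp: h_def)
  \<comment> \<open>The price \<open>1/2 - h\<close> is what a poor buyer has left after paying
    \<open>t\<close>.\<close>
  obtain v where v: "0 \<le> v" "v \<le> 1" "q v = 1/2 - h"
    using convex_pricing_IVT[OF q, of "1/2 - h"] B h by auto
  have vy: "v < y" using less_arg_if_less_price[OF q, of v y] v y h by auto
  have v0: "0 < v" using v h q by (cases "v = 0") (auto simp: convex_pricing_def)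
  define k where "k = (1 + y) / 2"
  define t where "t = 1/2 + h"
  define e where "e = real n + 1 - q 1"
  define a where "a = t / k"
  define d where "d = (e - t) / (1 - k)"
  have k: "1/2 \<le> k" "k < 1" using y y1 by (auto simp: k_def)
  have e: "e \<ge> (real n + 1) / 2" "e \<ge> 3/2" using B n by (auto simp: e_def)
  have t: "1/2 < t" "t \<le> 5/8" using h by (auto simp: t_def)
  have a0: "0 < a" using t k by (simp add: a_def)
  have ad: "a \<le> d"
  proof -
    \<comment> \<open>The claim \<open>a \<le> d\<close> amounts to \<open>t \<le> e * k\<close>,
      and \<open>t\<close> is at most 5/8.\<close>
    have "3/4 \<le> e * k" using mult_mono[of "3/2" e "1/2" k] e k by simp
    then have "t * (1 - k) \<le> (e - t) * k" using t by (simp add: algebra_simps)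
    then show ?thesis using k by (simp add: a_def d_def field_simps)
  qed
  let ?p = "kinked a d k"
  have p: "convex_pricing ?p"
    using a0 ad k by (intro convex_pricing_kinked) auto
  have pk: "?p k = t" using ad k by (simp add: kinked_below a_def)
  have p1: "?p 1 = e" using ad k by (simp add: kinked_above a_def d_def)
  have av: "a * v < q v"
  proof -
    have "t * v < t * y" using t vy by simp
    also have "\<dots> \<le> (1/2 - h) * k"
    proof -
      have "(1/2 - h) * k - t * y = 2 * h - h * k - h * y"
        by (simp add: t_def k_def h_def field_simps)
      also have "\<dots> = h * (2 - k - y)" by (simp add: algebra_simps)
      also have "\<dots> \<ge> 0" using h k y by simp
      finally show ?thesis by simp
    qed
    finally show ?thesis using k v(3) by (simp add: a_def pos_divide_less_eq mult.commute)
  qed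
  have "(real n - 1) * t + e > (real n - 1) * (1/2) + (real n + 1) / 2"
    using t e n by (intro add_less_le_mono mult_strict_left_mono) auto
  then have sum: "(real n - 1) * t + e > real n" by (simp add: field_simps)
  have poor: "t \<le> ?p x1" if "(x1, x2) \<in> demand 1 1 1 ?p q" for x1 x2
    using undercut_spending[OF p q, of k a 0 v 1 x1 x2] that k v v0 av pk q ad
    by (auto simp: kinked_below t_def convex_pricing_def algebra_simps)
  have rich: "e \<le> ?p x1" if "(x1, x2) \<in> demand 1 1 (real n + 1) ?p q" for x1 x2
    using full_purchase[OF p q _ that] p1 by (simp add: e_def)
  show thesis using that[OF p sum poor rich] .
qed

lemma secured_high_price:
  assumes q: "convex_pricing q" and n: "n \<ge> (2::nat)"
    and B: "(real n + 1) / 2 < q 1"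
  obtains p t e where "convex_pricing p" "(real n - 1) * t + e > real n"
    "\<And>x1 x2. (x1, x2) \<in> demand 1 1 1 p q \<Longrightarrow> t \<le> p x1"
    "\<And>x1 x2. (x1, x2) \<in> demand 1 1 (real n + 1) p q \<Longrightarrow> e \<le> p x1"
proof -
  obtain y where y: "0 \<le> y" "y \<le> 1" "q y = 1/2"
    using convex_pricing_IVT[OF q, of "1/2"] B n by auto
  obtain z where z: "0 \<le> z" "z \<le> 1" "q z = (real n + 1) / 2"
    using convex_pricing_IVT[OF q, of "(real n + 1) / 2"] B n by auto
  have y0: "0 < y" using y q by (cases "y = 0") (auto simp: convex_pricing_def)
  have yz: "y < z" using less_arg_if_less_price[OF q, of y z] y z n by auto
  have z1: "z < 1" using z B by (cases "z = 1") auto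
  define \<rho> where "\<rho> = (1 - y) / (z - y)"
  have \<rho>: "1 < \<rho>" using yz z1 by (simp add: \<rho>_def field_simps)
  \<comment> \<open>With the discount \<open>h / n\<close>, \<open>?F h\<close> is a lower bound for
    \<open>d * (1 - y) - (e - t)\<close>, so its positivity yields \<open>u \<le> 1\<close>. As
    \<open>h\<close> tends to 0 it tends to \<open>(\<rho> - 1) * n / 2\<close>, which is positive
    because \<open>z < 1\<close>.\<close>
  let ?F = "\<lambda>h. \<rho> * ((1 - h / n) * (n / 2 - h)) - (n / 2 + h + h / n / 2)"
  have "(?F \<longlongrightarrow> \<rho> * ((1 - 0 / n) * (n / 2 - 0)) - (n / 2 + 0 + 0 / n / 2)) (at_right 0)"
    using n by (intro tendsto_intros) auto
  moreover have "0 < \<rho> * ((1 - 0 / n) * (n / 2 - 0)) - (n / 2 + 0 + 0 / n / 2)"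
    using \<rho> n by simp
  ultimately have "eventually (\<lambda>h. 0 < ?F h) (at_right 0)"
    by (rule order_tendstoD)
  moreover have "eventually (\<lambda>h. h \<in> {0<..<1/2::real}) (at_right 0)"
    by (rule eventually_at_right_real) simp
  ultimately have "eventually (\<lambda>h. 0 < ?F h \<and> h \<in> {0<..<1/2::real}) (at_right 0)"
    by (rule eventually_conj)
  then obtain h where h: "0 < ?F h" "0 < h" "h < 1/2"
    using eventually_happens'[OF trivial_limit_at_right_real] by auto
  obtain v where v: "0 \<le> v" "v \<le> 1" "q v = (real n + 1) / 2 - h"
    using convex_pricing_IVT[OF q, of "(real n + 1) / 2 - h"] B n h by auto
  have yv: "y < v" using less_arg_if_less_price[OF q, of y v] y v n h by (simp add: field_simps)
  have vz: "v < z" using less_arg_if_less_price[OF q, of v z] z v h(2) by (simp add: field_simps)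
  \<comment> \<open>Discounting both chords by \<open>h / n\<close> lowers the guarantee from the
    \<open>n - 1\<close> poor buyers by less than \<open>h / 2\<close> in total, against the extra
    \<open>h\<close> from the rich buyer. The price \<open>e\<close> is reached at \<open>u\<close>,
    and \<open>q v\<close> is the rest of the rich budget.\<close>
  define \<epsilon> where "\<epsilon> = h / n"
  define r where "r = (q v - q y) / (v - y)"
  define a where "a = (1 - \<epsilon>) * (q y / y)"
  define d where "d = (1 - \<epsilon>) * r"
  define t where "t = (1 - \<epsilon>) / 2"
  define e where "e = (real n + 1) / 2 + h"
  define u where "u = y + (e - t) / d"
  have \<epsilon>: "0 < \<epsilon>" "\<epsilon> < 1" using h n by (auto simp: \<epsilon>_def field_simps)
  have qr: "q y / y \<le> r"
    using convex_on_chord_le[of "{0..1}" q 0 y y v] q y(1,2) v(1,2) y0 yv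
    by (auto simp: convex_pricing_def r_def)
  have a0: "0 < a" using \<epsilon> y y0 by (simp add: a_def)
  have ad: "a \<le> d" unfolding a_def d_def using qr \<epsilon> by (intro mult_left_mono) auto
  let ?p = "kinked a d y"
  have p: "convex_pricing ?p"
    using a0 ad y by (intro convex_pricing_kinked) auto
  have ay: "a * y = t" using y y0 by (simp add: a_def t_def)
  have py: "?p y = t" using ad ay by (simp add: kinked_below)
  have t: "t < 1/2" using \<epsilon>(1) by (simp add: t_def)
  have "1/2 < e" using h(2) by (simp add: e_def add_divide_distrib add_nonneg_pos)
  with t have et: "t < e" by simp
  have yu: "y \<le> u" using et a0 ad by (simp add: u_def)
  have pu: "?p u = e" using yu ad ay a0 by (simp add: kinked_above u_def)
  have u1: "u \<le> 1"
  proof -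
    have diff: "q v - q y = n / 2 - h"
      by (simp add: v(3) y(3) add_divide_distrib)
    have "e - t = n / 2 + h + \<epsilon> / 2"
      by (simp add: e_def t_def field_simps)
    also have "\<dots> \<le> (1 - \<epsilon>) * (n / 2 - h) * \<rho>"
      using h(1)[folded \<epsilon>_def] by (simp add: mult.commute)
    also have "\<dots> \<le> (1 - \<epsilon>) * (n / 2 - h) * ((1 - y) / (v - y))"
      unfolding \<rho>_def using \<epsilon> h n yv vz z1
      by (intro mult_left_mono divide_left_mono mult_nonneg_nonneg) auto
    also have "\<dots> = d * (1 - y)"
      by (simp add: d_def r_def diff)
    finally have "(e - t) / d \<le> 1 - y"
      using a0 ad by (simp add: pos_divide_le_eq mult.commute)
    then show ?thesis by (simp add: u_def)
  qed
  have poor: "t \<le> ?p x1" if "(x1, x2) \<in> demand 1 1 1 ?p q" for x1 x2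
  proof -
    have "a * y < q y" using ay t y by simp
    then show ?thesis
      using undercut_spending[OF p q, of y a 0 y 1 x1 x2] that y y0 py q ad t
      by (auto simp: kinked_below convex_pricing_def algebra_simps)
  qed
  have rich: "e \<le> ?p x1" if "(x1, x2) \<in> demand 1 1 (real n + 1) ?p q" for x1 x2
  proof -
    have "0 < q y / y" using y(3) y0 by simp
    then have "0 < r" using qr by (rule less_le_trans)
    then have "d < r" using \<epsilon> by (simp add: d_def)
    then have "d * (v - y) < q v - q y" using yv by (simp add: r_def less_divide_eq)
    moreover have "q v \<le> real n + 1 - ?p u" unfolding pu v(3) e_def by (simp add: field_simps)
    \<comment> \<open>The comparison chord starts at \<open>y\<close>, not at 0: no piece of the
      deviation is steeper than \<open>d\<close>, and \<open>d\<close> is below the slope of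
      \<open>q\<close> over \<open>[y, v]\<close>.\<close>
    ultimately show ?thesis
      using undercut_spending[OF p q, of u d y v "real n + 1" x1 x2] that
        yu u1 y v yv pu kinked_slope_le[OF ad] by auto
  qed
  have "(real n - 1) * t + e - real n = (h + \<epsilon>) / 2"
    using n by (simp add: t_def e_def \<epsilon>_def field_simps)
  moreover have "0 < (h + \<epsilon>) / 2" using h(2) \<epsilon>(1) by simp
  ultimately have sum: "(real n - 1) * t + e > real n" by linarith
  show thesis using that[OF p sum poor rich] .
qed

text \<open>The guarantees \<open>t\<close> per poor buyer and \<open>e\<close> from the rich one
  hold at every maximizer, hence under every tie-breaking rule.\<close>

lemma secured_revenue:
  assumes q: "convex_pricing q" and n: "n \<ge> (2::nat)"
  obtains p t e where "convex_pricing p" "(real n - 1) * t + e > real n"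
    "\<And>x1 x2. (x1, x2) \<in> demand 1 1 1 p q \<Longrightarrow> t \<le> p x1"
    "\<And>x1 x2. (x1, x2) \<in> demand 1 1 (real n + 1) p q \<Longrightarrow> e \<le> p x1"
proof (cases "q 1 < 1")
  case True
  define e where "e = real n + 1 - q 1"
  let ?p = "kinked e e 0"
  have e: "real n < e" using True by (simp add: e_def)
  have p: "convex_pricing ?p" using e by (intro convex_pricing_kinked) auto
  have "0 \<le> ?p x1" if "(x1, x2) \<in> demand 1 1 1 ?p q" for x1 x2
    using that p by (auto simp: demand_unit_iff budget_set_def convex_pricing_def)
  moreover have "e \<le> ?p x1" if "(x1, x2) \<in> demand 1 1 (real n + 1) ?p q" for x1 x2
    using full_purchase[OF p q _ that] by (simp add: e_def kinked_def)
  ultimately show thesis using that[of ?p 0 e] p e by auto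
next
  case False
  show thesis
  proof (cases "q 1 \<le> (real n + 1) / 2")
    case True
    with False show thesis using secured_low_price[OF q n] that by (metis not_less)
  next
    case False
    then show thesis using secured_high_price[OF q n] that by (metis not_less)
  qed
qed

section \<open>Summation over the buyers and the contradiction\<close>

lemma sum_market_ge:
  fixes f :: "nat \<Rightarrow> real"
  assumes "n \<ge> 1" and "\<And>i. i \<in> {1..<n} \<Longrightarrow> t \<le> f i" and "e \<le> f n"
  shows "(real n - 1) * t + e \<le> (\<Sum>i\<in>{1..n}. f i)"
proof -
  have "(real n - 1) * t = (\<Sum>i\<in>{1..<n}. t)" using assms(1) by (simp add: of_nat_diff)
  also have "\<dots> \<le> (\<Sum>i\<in>{1..<n}. f i)" using assms(2) by (intro sum_mono)
  finally have "(real n - 1) * t + e \<le> (\<Sum>i\<in>{1..<n}. f i) + f n" using assms(3) by simp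
  also have "\<dots> = (\<Sum>i\<in>{1..n}. f i)"
    using assms(1) by (simp add: atLeastLessThanSuc_atLeastAtMost[symmetric])
  finally show ?thesis .
qed

lemma sum_market_budget:
  assumes "n \<ge> 1"
  shows "(\<Sum>i\<in>{1..n}. market_budget n i) = 2 * real n"
proof -
  have "(\<Sum>i\<in>{1..n}. market_budget n i) = (\<Sum>i\<in>{1..<n}. market_budget n i) + market_budget n n"
    using assms by (simp add: atLeastLessThanSuc_atLeastAtMost[symmetric])
  also have "(\<Sum>i\<in>{1..<n}. market_budget n i) = (\<Sum>i\<in>{1..<n}. 1)"
    by (intro sum.cong) (auto simp: market_budget_def)
  finally show ?thesis using assms by (simp add: market_budget_def of_nat_diff)
qed

theorem theorem2:
  fixes n :: nat and sel :: selection
  assumes "n \<ge> 2"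
    and "tie_breaking_rule n (\<lambda>_. 1) (\<lambda>_. 1) (market_budget n) sel"
  shows "\<not> (\<exists>p1 p2. nash_equilibrium n sel p1 p2)"
proof
  assume "\<exists>p1 p2. nash_equilibrium n sel p1 p2"
  then obtain p1 p2 where p1: "convex_pricing p1" and p2: "convex_pricing p2"
    and best1: "\<And>p. convex_pricing p \<Longrightarrow> revenue1 n sel p p2 \<le> revenue1 n sel p1 p2"
    and best2: "\<And>p. convex_pricing p \<Longrightarrow> revenue2 n sel p1 p \<le> revenue2 n sel p1 p2"
    by (auto simp: nash_equilibrium_def)
  have sel: "(fst (sel i q1 q2), snd (sel i q1 q2)) \<in> demand 1 1 (market_budget n i) q1 q2"
    if "i \<in> {1..n}" "convex_pricing q1" "convex_pricing q2" for i q1 q2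
    using assms(2) that by (auto simp: tie_breaking_rule_def)
  have rev1: "real n < revenue1 n sel p1 p2"
  proof -
    obtain p t e where p: "convex_pricing p" and sum: "(real n - 1) * t + e > real n"
      and poor: "\<And>x1 x2. (x1, x2) \<in> demand 1 1 1 p p2 \<Longrightarrow> t \<le> p x1"
      and rich: "\<And>x1 x2. (x1, x2) \<in> demand 1 1 (real n + 1) p p2 \<Longrightarrow> e \<le> p x1"
      using secured_revenue[OF p2 assms(1)] by metis
    have "(real n - 1) * t + e \<le> revenue1 n sel p p2"
      unfolding revenue1_def
    proof (rule sum_market_ge)
      show "t \<le> p (fst (sel i p p2))" if "i \<in> {1..<n}" for i
        using sel[OF _ p p2, of i] that poor[of _ "snd (sel i p p2)"] by (simp add: market_budget_def)
      show "e \<le> p (fst (sel n p p2))"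
        using sel[OF _ p p2, of n] assms(1) rich[of _ "snd (sel n p p2)"] by (simp add: market_budget_def)
    qed (use assms(1) in simp)
    with sum best1[OF p] show ?thesis by simp
  qed
  have rev2: "real n < revenue2 n sel p1 p2"
  proof -
    obtain p t e where p: "convex_pricing p" and sum: "(real n - 1) * t + e > real n"
      and poor: "\<And>x2 x1. (x2, x1) \<in> demand 1 1 1 p p1 \<Longrightarrow> t \<le> p x2"
      and rich: "\<And>x2 x1. (x2, x1) \<in> demand 1 1 (real n + 1) p p1 \<Longrightarrow> e \<le> p x2"
      using secured_revenue[OF p1 assms(1)] by metis
    \<comment> \<open>The selection is still evaluated at \<open>(p1, p)\<close>; only membership in
      the demand set is mirrored.\<close>
    have swap: "(snd (sel i p1 p), fst (sel i p1 p)) \<in> demand 1 1 (market_budget n i) p p1"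
      if "i \<in> {1..n}" for i
      using sel[OF that p1 p] demand_unit_swap by blast
    have "(real n - 1) * t + e \<le> revenue2 n sel p1 p"
      unfolding revenue2_def
    proof (rule sum_market_ge)
      show "t \<le> p (snd (sel i p1 p))" if "i \<in> {1..<n}" for i
        using swap[of i] that poor[of _ "fst (sel i p1 p)"] by (simp add: market_budget_def)
      show "e \<le> p (snd (sel n p1 p))"
        using swap[of n] assms(1) rich[of _ "fst (sel n p1 p)"] by (simp add: market_budget_def)
    qed (use assms(1) in simp)
    with sum best2[OF p] show ?thesis by simp
  qed
  have "p1 (fst (sel i p1 p2)) + p2 (snd (sel i p1 p2)) \<le> market_budget n i"
    if "i \<in> {1..n}" for i
    using sel[OF that p1 p2]
    unfolding demand_unit_iff budget_set_def mem_Collect_eq case_prod_conv by blast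
  then have "revenue1 n sel p1 p2 + revenue2 n sel p1 p2 \<le> (\<Sum>i\<in>{1..n}. market_budget n i)"
    unfolding revenue1_def revenue2_def sum.distrib[symmetric]
    by (rule sum_mono)
  with rev1 rev2 sum_market_budget[of n] assms(1) show False by simp
qed

end
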